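(* Let $Y$ be a real random variable with finite second moment, $G\in\{0,1\}$ a random variable, and $X$ a random vector in $\mathbb{R}^k$ (the available features), all on a common probability space. Let $W\subseteq X$ denote a subset of the features (the random vector formed by some of the coordinates of $X$), and define $Z=\mathbb{E}[Y\mid W]$. Suppose: (A1) $\mathbb{E}[\mathrm{Var}(Y\mid W)]>0$; (A2) $Y\perp G\mid W$ ($Y$ and $G$ are conditionally independent given $W$); (A3) $W\perp G\mid Y$ ($W$ and $G$ are conditionally independent given $Y$); (A4) $\mathrm{Var}(\mathbb{E}[G\mid W])>0$. Then: $Z$ is globally calibrated, i.e. $\mathbb{E}[Y\mid Z=z]=z$ for all $z$; $G$ and $Y$ are not independent; $Z$ is not an oracle, i.e. $\mathbb{E}[(Y-Z)^2]>0$; and $\delta_C(z)=0$ for all $z$ and $\delta_B(y)=0$ for all $y$.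
   Context: Pointwise miscalibration within groups: $\delta_C(z)=\mathbb{E}[Y\mid Z=z,G=1]-\mathbb{E}[Y\mid Z=z,G=0]$. Pointwise imbalance across groups: $\delta_B(y)=\mathbb{E}[Z\mid Y=y,G=1]-\mathbb{E}[Z\mid Y=y,G=0]$. A score $Z$ is an oracle if $Z=Y$ almost surely, equivalently its mean squared error $\mathbb{E}[(Y-Z)^2]$ is $0$. Convention: "for all $z$" and "for all $y$" refer to almost every value under the law of $Z$, resp. $Y$, at which the conditional quantities for both groups are defined; equivalently $\mathbb{E}[Y\mid Z]=Z$ a.s., $\mathbb{E}[Y\mid Z,G]=\mathbb{E}[Y\mid Z]$ a.s., and $\mathbb{E}[Z\mid Y,G]=\mathbb{E}[Z\mid Y]$ a.s. *)

theory Defs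
  imports "HOL-Probability.Probability"
begin

abbreviation cexp :: "'a measure \<Rightarrow> 'b measure \<Rightarrow> ('a \<Rightarrow> 'b) \<Rightarrow> ('a \<Rightarrow> real) \<Rightarrow> 'a \<Rightarrow> real" where
  "cexp M N V f \<equiv> real_cond_exp M (vimage_algebra (space M) V N) f"

definition cond_variance ::
    "'a measure \<Rightarrow> 'b measure \<Rightarrow> ('a \<Rightarrow> 'b) \<Rightarrow> ('a \<Rightarrow> real) \<Rightarrow> 'a \<Rightarrow> real" where
  "cond_variance M N V f = cexp M N V (\<lambda>\<omega>. (f \<omega> - cexp M N V f \<omega>)\<^sup>2)"

definition cond_indep_var ::
    "'a measure \<Rightarrow> 'b measure \<Rightarrow> ('a \<Rightarrow> 'b) \<Rightarrow> 'c measure \<Rightarrow> ('a \<Rightarrow> 'c) \<Rightarrow>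
     'd measure \<Rightarrow> ('a \<Rightarrow> 'd) \<Rightarrow> bool" where
  "cond_indep_var M NA A NB B NV V \<longleftrightarrow>
     (\<forall>S\<in>sets NA. \<forall>T\<in>sets NB. AE \<omega> in M.
        cexp M NV V (indicator {\<omega>\<in>space M. A \<omega> \<in> S \<and> B \<omega> \<in> T}) \<omega> =
        cexp M NV V (indicator {\<omega>\<in>space M. A \<omega> \<in> S}) \<omega> *
        cexp M NV V (indicator {\<omega>\<in>space M. B \<omega> \<in> T}) \<omega>)"

(* E[f | V = v] as a function of v, i.e. a measurable function g such that g(V) is a version of
   E[f | V].  It is determined up to null sets of the law of V; such a g always exists
   (lemma cond_exp_at_exists below). *)
definition cond_exp_at ::
    "'a measure \<Rightarrow> 'b measure \<Rightarrow> ('a \<Rightarrow> 'b) \<Rightarrow> ('a \<Rightarrow> real) \<Rightarrow> 'b \<Rightarrow> real" where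
  "cond_exp_at M N V f =
     (SOME g. g \<in> borel_measurable N \<and> (AE \<omega> in M. g (V \<omega>) = cexp M N V f \<omega>))"

lemma factor_through_vimage_algebra:
  fixes f :: "'a \<Rightarrow> real"
  assumes V: "V \<in> X \<rightarrow> space N" and f: "f \<in> borel_measurable (vimage_algebra X V N)"
  shows "\<exists>g\<in>borel_measurable N. \<forall>\<omega>\<in>X. g (V \<omega>) = f \<omega>"
proof -
  have simple: "\<exists>g\<in>borel_measurable N. \<forall>\<omega>\<in>X. g (V \<omega>) = s \<omega>"
    if s: "simple_function (vimage_algebra X V N) s" for s :: "'a \<Rightarrow> real"
  proof -
    have fin: "finite (s ` X)"
      using simple_functionD(1)[OF s] by simp
    have "\<exists>A\<in>sets N. s -` {y} \<inter> X = V -` A \<inter> X" for y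
      using simple_functionD(2)[OF s, of "{y}"] sets_vimage_algebra2[OF V] by auto
    then obtain A where A: "\<And>y. A y \<in> sets N" "\<And>y. s -` {y} \<inter> X = V -` A y \<inter> X"
      by metis
    define g where "g = (\<lambda>v. \<Sum>y\<in>s ` X. y * indicator (A y) v :: real)"
    have "g \<in> borel_measurable N"
      unfolding g_def using A(1) by measurable
    moreover have "g (V \<omega>) = s \<omega>" if "\<omega> \<in> X" for \<omega>
    proof -
      have "V \<omega> \<in> A y \<longleftrightarrow> s \<omega> = y" for y
        using A(2)[of y] that by blast
      then have "g (V \<omega>) = (\<Sum>y\<in>s ` X. if s \<omega> = y then y else 0)"
        unfolding g_def by (intro sum.cong) (auto simp: indicator_def)
      also have "\<dots> = s \<omega>"
        using fin that by simp
      finally show ?thesis .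
    qed
    ultimately show ?thesis by blast
  qed
  obtain s where s: "\<And>i. simple_function (vimage_algebra X V N) (s i)"
      "\<And>\<omega>. \<omega> \<in> X \<Longrightarrow> (\<lambda>i. s i \<omega>) \<longlonglongrightarrow> f \<omega>"
    using borel_measurable_implies_sequence_metric[OF f, of 0] by auto
  obtain g where g: "\<And>i. g i \<in> borel_measurable N" "\<And>i \<omega>. \<omega> \<in> X \<Longrightarrow> g i (V \<omega>) = s i \<omega>"
    using simple[OF s(1)] by metis
  show ?thesis
  proof (intro bexI ballI)
    show "(\<lambda>v. lim (\<lambda>i. g i v)) \<in> borel_measurable N"
      using g(1) by (rule borel_measurable_lim_metric)
    show "lim (\<lambda>i. g i (V \<omega>)) = f \<omega>" if "\<omega> \<in> X" for \<omega>
      using s(2)[OF that] g(2)[OF that] by (simp add: limI)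
  qed
qed

lemma cond_exp_at_exists:
  assumes "V \<in> measurable M N"
  shows "\<exists>g\<in>borel_measurable N. \<forall>\<omega>\<in>space M. g (V \<omega>) = cexp M N V f \<omega>"
  using assms
  by (intro factor_through_vimage_algebra) (auto simp: measurable_space)

lemma
  assumes "V \<in> measurable M N"
  shows cond_exp_at_measurable: "cond_exp_at M N V f \<in> borel_measurable N"
    and AE_cond_exp_at: "AE \<omega> in M. cond_exp_at M N V f (V \<omega>) = cexp M N V f \<omega>"
proof -
  have "\<exists>g. g \<in> borel_measurable N \<and> (AE \<omega> in M. g (V \<omega>) = cexp M N V f \<omega>)"
    using cond_exp_at_exists[OF assms] by (meson AE_I2)
  from someI_ex[OF this, folded cond_exp_at_def]
  show "cond_exp_at M N V f \<in> borel_measurable N"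
    and "AE \<omega> in M. cond_exp_at M N V f (V \<omega>) = cexp M N V f \<omega>"
    by auto
qed

(* E[f | V = v, G = 1] - E[f | V = v, G = 0] *)
definition group_gap ::
    "'a measure \<Rightarrow> ('a \<Rightarrow> real) \<Rightarrow> ('a \<Rightarrow> real) \<Rightarrow> ('a \<Rightarrow> real) \<Rightarrow> real \<Rightarrow> real" where
  "group_gap M G V f v =
     cond_exp_at M borel (\<lambda>\<omega>. (V \<omega>, G \<omega>)) f (v, 1) -
     cond_exp_at M borel (\<lambda>\<omega>. (V \<omega>, G \<omega>)) f (v, 0)"

definition miscalibration ("\<delta>\<^sub>C") where
  "\<delta>\<^sub>C M G Y Z z = group_gap M G Z Y z"

definition imbalance ("\<delta>\<^sub>B") where
  "\<delta>\<^sub>B M G Y Z y = group_gap M G Y Z y"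

(* Both groups occur with positive conditional probability P(G = g | V = v).  The values
   E[f | V = v, G = g] are determined, up to null sets of the law of V, exactly where
   P(G = g | V = v) > 0; elsewhere they are an arbitrary choice of version. *)
definition both_groups_at ::
    "'a measure \<Rightarrow> ('a \<Rightarrow> real) \<Rightarrow> ('a \<Rightarrow> real) \<Rightarrow> real \<Rightarrow> bool" where
  "both_groups_at M G V v \<longleftrightarrow>
     (\<forall>g\<in>{0, 1}. 0 < cond_exp_at M borel V (indicator {\<omega>\<in>space M. G \<omega> = g}) v)"

definition globally_calibrated :: "'a measure \<Rightarrow> ('a \<Rightarrow> real) \<Rightarrow> ('a \<Rightarrow> real) \<Rightarrow> bool" where
  "globally_calibrated M Y Z \<longleftrightarrow> (AE z in distr M borel Z. cond_exp_at M borel Z Y z = z)"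

definition oracle_score :: "'a measure \<Rightarrow> ('a \<Rightarrow> real) \<Rightarrow> ('a \<Rightarrow> real) \<Rightarrow> bool" where
  "oracle_score M Y Z \<longleftrightarrow> (AE \<omega> in M. Z \<omega> = Y \<omega>)"

end

theory Submission
  imports Defs
begin

text \<open>
  Let \<open>1\<^sub>g\<close> be the indicator of \<open>G = g\<close>. Conditional independence of \<open>f\<close> and \<open>G\<close> given \<open>V\<close>
  yields \<open>E[f 1\<^sub>g | V] = E[f | V] P(G = g | V)\<close>, while the definition of \<open>E[f | V, G]\<close> yields
  \<open>E[f 1\<^sub>g | V] = E[f | V, G = g] P(G = g | V)\<close>. Cancelling wherever both group probabilities are
  positive shows that the gap vanishes: for \<open>\<delta>\<^sub>B\<close> directly with \<open>V = Y\<close>, for \<open>\<delta>\<^sub>C\<close> after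
  projecting the identity \<open>E[Y 1\<^sub>g | W] = Z P(G = g | W)\<close> from \<open>W\<close> to \<open>Z\<close>. If \<open>G\<close> were
  independent of \<open>Y\<close>, then (A3) would make \<open>G\<close> independent of \<open>W\<close>, so that \<open>E[G | W]\<close> would be
  constant, against (A4).
\<close>

section \<open>Generated sub-sigma-algebras and bounded multipliers\<close>

lemma (in finite_measure) finite_measure_subalgebra_vimage:
  assumes "V \<in> measurable M N"
  shows "finite_measure_subalgebra M (vimage_algebra (space M) V N)"
proof
  show "subalgebra M (vimage_algebra (space M) V N)"
    using assms by (auto simp: subalgebra_def sets_vimage_algebra2 measurable_space)
qed

text \<open>Makes the tower property available: from \<open>W\<close> down to \<open>Z\<close>, and
  from the pair \<open>(V, G)\<close> down to \<open>V\<close>.\<close>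

lemma subalgebra_vimage_vimage:
  assumes "U \<in> X \<rightarrow> space K"
    and "U \<in> measurable (vimage_algebra X V N) K"
  shows "subalgebra (vimage_algebra X V N) (vimage_algebra X U K)"
proof -
  have "U -` A \<inter> X \<in> sets (vimage_algebra X V N)" if "A \<in> sets K" for A
    using measurable_sets[OF assms(2) that] by simp
  then show ?thesis
    by (auto simp: subalgebra_def sets_vimage_algebra2[OF assms(1)])
qed

text \<open>The bound is asked for only almost everywhere because conditional probabilities, which
  serve as multipliers below, lie in [0, 1] only almost everywhere.\<close>

lemma (in finite_measure) integrable_mult_AE_bounded:
  fixes f h :: "'a \<Rightarrow> real"
  assumes f: "integrable M f" and h: "h \<in> borel_measurable M" "AE \<omega> in M. \<bar>h \<omega>\<bar> \<le> c"
  shows "integrable M (\<lambda>\<omega>. h \<omega> * f \<omega>)"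
proof (rule Bochner_Integration.integrable_bound)
  show "integrable M (\<lambda>\<omega>. c * f \<omega>)"
    using f by simp
  show "(\<lambda>\<omega>. h \<omega> * f \<omega>) \<in> borel_measurable M"
    using f h by measurable
  show "AE \<omega> in M. norm (h \<omega> * f \<omega>) \<le> norm (c * f \<omega>)"
    using h(2) by eventually_elim (auto simp: abs_mult intro!: mult_right_mono)
qed

lemma (in finite_measure_subalgebra) AE_abs_real_cond_exp_indicator_le_1:
  assumes E: "E \<in> sets M"
  shows "AE \<omega> in M. \<bar>real_cond_exp M F (indicator E) \<omega>\<bar> \<le> 1"
proof -
  have int: "integrable M (indicator E :: 'a \<Rightarrow> real)"
    using E by (simp add: less_top[symmetric])
  have "AE \<omega> in M. real_cond_exp M F (indicator E) \<omega> \<ge> 0"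
    by (rule real_cond_exp_ge_c[OF int]) simp
  moreover have "AE \<omega> in M. real_cond_exp M F (indicator E) \<omega> \<le> 1"
    by (rule real_cond_exp_le_c[OF int]) (simp add: indicator_def)
  ultimately show ?thesis
    by eventually_elim simp
qed

section \<open>Conditional independence, from events to integrable functions\<close>

text \<open>Let I be the indicator of \<open>B\<close> in \<open>T\<close> and P its conditional
  probability given \<open>V\<close>. For each C in sigma(V), conditional independence makes 1_C (I
  - P) orthogonal to every event of sigma(A), hence to \<open>f\<close>. So 1_C I and 1_C P have the
  same integral against \<open>f\<close>, and in the second one \<open>f\<close> may be replaced by
  E[f | V].\<close>

lemma (in finite_measure) cond_indep_var_cexp_mult:
  fixes f :: "'a \<Rightarrow> real"
  assumes A: "A \<in> measurable M NA" and B: "B \<in> measurable M NB" and V: "V \<in> measurable M NV"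
    and ci: "cond_indep_var M NA A NB B NV V"
    and f: "integrable M f" "f \<in> borel_measurable (vimage_algebra (space M) A NA)"
    and T: "T \<in> sets NB"
  shows "AE \<omega> in M. cexp M NV V (\<lambda>\<omega>. f \<omega> * indicator {\<omega>\<in>space M. B \<omega> \<in> T} \<omega>) \<omega> =
    cexp M NV V f \<omega> * cexp M NV V (indicator {\<omega>\<in>space M. B \<omega> \<in> T}) \<omega>"
proof -
  define I :: "'a \<Rightarrow> real" where "I = indicator {\<omega>\<in>space M. B \<omega> \<in> T}"
  define P where "P = cexp M NV V I"
  define FA where "FA = vimage_algebra (space M) A NA"
  define FV where "FV = vimage_algebra (space M) V NV"
  interpret A: finite_measure_subalgebra M FA
    unfolding FA_def by (rule finite_measure_subalgebra_vimage[OF A])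
  interpret V: finite_measure_subalgebra M FV
    unfolding FV_def by (rule finite_measure_subalgebra_vimage[OF V])
  have BT [measurable]: "{\<omega>\<in>space M. B \<omega> \<in> T} \<in> sets M"
    using B T by measurable
  have [measurable]: "f \<in> borel_measurable M" "f \<in> borel_measurable FA"
    using f by (auto simp: FA_def)
  have I [measurable]: "I \<in> borel_measurable M" "integrable M I" "AE \<omega> in M. \<bar>I \<omega>\<bar> \<le> 1"
    using BT by (auto simp: I_def less_top[symmetric])
  have PV [measurable]: "P \<in> borel_measurable FV" "P \<in> borel_measurable M"
    by (simp_all add: P_def FV_def)
  have P1: "AE \<omega> in M. \<bar>P \<omega>\<bar> \<le> 1"
    unfolding P_def I_def FV_def[symmetric]
    by (rule V.AE_abs_real_cond_exp_indicator_le_1) measurable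
  have intf: "integrable M (\<lambda>\<omega>. I \<omega> * f \<omega>)"
    by (rule integrable_mult_AE_bounded[OF f(1) I(1,3)])
  have "AE \<omega> in M. real_cond_exp M FV (\<lambda>\<omega>. f \<omega> * I \<omega>) \<omega> = real_cond_exp M FV f \<omega> * P \<omega>"
  proof (rule V.real_cond_exp_charact)
    fix C assume C [measurable]: "C \<in> sets FV"
    have CM [measurable]: "C \<in> sets M"
      using V.subalg C by (auto simp: subalgebra_def)
    have C1: "AE \<omega> in M. \<bar>indicator C \<omega> :: real\<bar> \<le> 1"
      by (simp add: indicator_def)
    have CP: "AE \<omega> in M. \<bar>indicator C \<omega> * P \<omega>\<bar> \<le> 1"
      using P1 by eventually_elim (simp add: indicator_def)
    have CI: "AE \<omega> in M. \<bar>indicator C \<omega> * I \<omega>\<bar> \<le> 1"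
      by (simp add: indicator_def I_def)
    define u where "u \<omega> = indicator C \<omega> * I \<omega> - indicator C \<omega> * P \<omega>" for \<omega>
    have u [measurable]: "u \<in> borel_measurable M"
      unfolding u_def by measurable
    have u2: "AE \<omega> in M. \<bar>u \<omega>\<bar> \<le> 2"
      using CP CI unfolding u_def by eventually_elim linarith
    have u_int: "integrable M u"
      using u2 by (intro integrable_const_bound[of _ 2]) simp_all
    \<comment> \<open>Testing \<open>u\<close> against \<open>\<sigma>(A)\<close> only needs indicators, which the hypothesis covers; the
      vanishing of \<open>E[u | A]\<close> then gives \<open>E[f u] = 0\<close> without approximating \<open>f\<close> by simple functions.\<close>
    have "AE \<omega> in M. real_cond_exp M FA u \<omega> = 0"
    proof (rule A.real_cond_exp_charact)
      fix D assume "D \<in> sets FA"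
      then obtain S where S: "S \<in> sets NA" "D = {\<omega>\<in>space M. A \<omega> \<in> S}"
        using A by (auto simp: FA_def sets_vimage_algebra2 measurable_space)
      define J :: "'a \<Rightarrow> real" where "J = indicator D"
      have DM [measurable]: "D \<in> sets M"
        using S A by simp
      have J [measurable]: "J \<in> borel_measurable M" "integrable M J" "AE \<omega> in M. \<bar>J \<omega>\<bar> \<le> 1"
        using DM by (auto simp: J_def less_top[symmetric])
      have JI: "integrable M (\<lambda>\<omega>. J \<omega> * I \<omega>)"
        by (rule integrable_mult_AE_bounded[OF I(2) J(1,3)])
      have ciJ: "AE \<omega> in M. real_cond_exp M FV (\<lambda>\<omega>. J \<omega> * I \<omega>) \<omega> = real_cond_exp M FV J \<omega> * P \<omega>"
      proof -
        have "(\<lambda>\<omega>. J \<omega> * I \<omega>) = indicator {\<omega>\<in>space M. A \<omega> \<in> S \<and> B \<omega> \<in> T}"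
          by (auto simp: J_def I_def S indicator_def)
        then show ?thesis
          using ci S T unfolding cond_indep_var_def P_def I_def J_def FV_def S(2) by auto
      qed
      \<comment> \<open>A round trip through sigma(V): condition \<open>J * I\<close> on
        \<open>V\<close>, split it by the hypothesis, then undo the conditioning of
        \<open>J\<close>, since \<open>indicator C * P\<close> is sigma(V)-measurable.\<close>
      have "(\<integral>\<omega>. J \<omega> * (indicator C \<omega> * I \<omega>) \<partial>M) = (\<integral>\<omega>. indicator C \<omega> * (J \<omega> * I \<omega>) \<partial>M)"
        by (simp add: ac_simps)
      also have "\<dots> = (\<integral>\<omega>. indicator C \<omega> * real_cond_exp M FV (\<lambda>\<omega>. J \<omega> * I \<omega>) \<omega> \<partial>M)"
        by (rule V.real_cond_exp_intg(2)[symmetric])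
          (use integrable_mult_AE_bounded[OF JI _ C1] in simp_all)
      also have "\<dots> = (\<integral>\<omega>. (indicator C \<omega> * P \<omega>) * real_cond_exp M FV J \<omega> \<partial>M)"
        using ciJ by (intro integral_cong_AE) auto
      also have "\<dots> = (\<integral>\<omega>. (indicator C \<omega> * P \<omega>) * J \<omega> \<partial>M)"
        by (rule V.real_cond_exp_intg(2))
          (use integrable_mult_AE_bounded[OF J(2) _ CP] in simp_all)
      finally have eq: "(\<integral>\<omega>. J \<omega> * (indicator C \<omega> * I \<omega>) \<partial>M) =
        (\<integral>\<omega>. J \<omega> * (indicator C \<omega> * P \<omega>) \<partial>M)"
        by (simp add: ac_simps)
      have "integrable M (\<lambda>\<omega>. J \<omega> * (indicator C \<omega> * I \<omega>))"
        "integrable M (\<lambda>\<omega>. J \<omega> * (indicator C \<omega> * P \<omega>))"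
        using integrable_mult_AE_bounded[OF J(2) _ CP] integrable_mult_AE_bounded[OF J(2) _ CI]
        by (simp_all add: ac_simps)
      with eq show "(\<integral>\<omega>\<in>D. u \<omega> \<partial>M) = (\<integral>\<omega>\<in>D. 0 \<partial>M)"
        by (simp add: set_lebesgue_integral_def u_def J_def right_diff_distrib)
    qed (simp_all add: u_int)
    \<comment> \<open>As \<open>f\<close> is sigma(A)-measurable, E[f u] = E[f E[u | A]].\<close>
    then have "(\<integral>\<omega>. f \<omega> * real_cond_exp M FA u \<omega> \<partial>M) = (\<integral>\<omega>. 0 \<partial>M)"
      by (intro integral_cong_AE) auto
    moreover have "integrable M (\<lambda>\<omega>. f \<omega> * u \<omega>)"
      using integrable_mult_AE_bounded[OF f(1) u u2] by (simp add: mult.commute)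
    ultimately have "(\<integral>\<omega>. f \<omega> * u \<omega> \<partial>M) = 0"
      using A.real_cond_exp_intg(2)[of f u] by simp
    moreover have fCP: "integrable M (\<lambda>\<omega>. (indicator C \<omega> * P \<omega>) * f \<omega>)"
      by (rule integrable_mult_AE_bounded[OF f(1) _ CP]) measurable
    moreover have fCI: "integrable M (\<lambda>\<omega>. (indicator C \<omega> * I \<omega>) * f \<omega>)"
      by (rule integrable_mult_AE_bounded[OF f(1) _ CI]) measurable
    moreover have "(\<lambda>\<omega>. f \<omega> * u \<omega>) = (\<lambda>\<omega>. (indicator C \<omega> * I \<omega>) * f \<omega> - (indicator C \<omega> * P \<omega>) * f \<omega>)"
      by (simp add: u_def algebra_simps)
    ultimately have "(\<integral>\<omega>. (indicator C \<omega> * I \<omega>) * f \<omega> \<partial>M) = (\<integral>\<omega>. (indicator C \<omega> * P \<omega>) * f \<omega> \<partial>M)"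
      by simp
    also have "\<dots> = (\<integral>\<omega>. (indicator C \<omega> * P \<omega>) * real_cond_exp M FV f \<omega> \<partial>M)"
      by (rule V.real_cond_exp_intg(2)[symmetric, OF fCP]) measurable
    finally show "(\<integral>\<omega>\<in>C. f \<omega> * I \<omega> \<partial>M) = (\<integral>\<omega>\<in>C. real_cond_exp M FV f \<omega> * P \<omega> \<partial>M)"
      by (simp add: set_lebesgue_integral_def ac_simps)
  next
    show "integrable M (\<lambda>\<omega>. f \<omega> * I \<omega>)"
      using intf by (simp add: mult.commute)
    show "integrable M (\<lambda>\<omega>. real_cond_exp M FV f \<omega> * P \<omega>)"
      using integrable_mult_AE_bounded[OF V.real_cond_exp_int(1)[OF f(1)] PV(2) P1]
      by (simp add: mult.commute)
  qed measurable
  then show ?thesis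
    by (simp add: P_def I_def FV_def)
qed

section \<open>Vanishing of the gap between the two groups\<close>

text \<open>One factor \<open>c\<close> serves both groups, so cancelling P(G = g | V) identifies
  both group values with \<open>c\<close>. Leaving \<open>c\<close> abstract covers miscalibration
  (\<open>c = Z\<close>) and imbalance (\<open>c\<close> = E[Z | Y]) at once.\<close>

lemma (in finite_measure) AE_group_gap_eq_0:
  fixes f G V c :: "'a \<Rightarrow> real"
  assumes [measurable]: "V \<in> borel_measurable M" "G \<in> borel_measurable M"
    and f: "integrable M f"
    and c: "\<And>g. g \<in> {0, 1} \<Longrightarrow> AE \<omega> in M.
      cexp M borel V (\<lambda>\<omega>. f \<omega> * indicator {\<omega>\<in>space M. G \<omega> = g} \<omega>) \<omega> =
      c \<omega> * cexp M borel V (indicator {\<omega>\<in>space M. G \<omega> = g}) \<omega>"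
  shows "AE v in distr M borel V. both_groups_at M G V v \<longrightarrow> group_gap M G V f v = 0"
proof -
  define VG where "VG \<omega> = (V \<omega>, G \<omega>)" for \<omega>
  define h where "h = cond_exp_at M borel VG f"
  define p where "p g = cond_exp_at M borel V (indicator {\<omega>\<in>space M. G \<omega> = g})" for g
  define F1 where "F1 = vimage_algebra (space M) V borel"
  define F2 where "F2 = vimage_algebra (space M) VG borel"
  have VG [measurable]: "VG \<in> borel_measurable M"
    unfolding VG_def by measurable
  interpret F1: finite_measure_subalgebra M F1
    unfolding F1_def by (rule finite_measure_subalgebra_vimage) measurable
  interpret F2: finite_measure_subalgebra M F2
    unfolding F2_def by (rule finite_measure_subalgebra_vimage[OF VG])
  have VG2 [measurable]: "VG \<in> borel_measurable F2"
    unfolding F2_def by (rule measurable_vimage_algebra1) simp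
  have V1 [measurable]: "V \<in> borel_measurable F1"
    unfolding F1_def by (rule measurable_vimage_algebra1) simp
  have V2 [measurable]: "V \<in> borel_measurable F2" and G2 [measurable]: "G \<in> borel_measurable F2"
    using borel_measurable_continuous_on[OF continuous_on_fst[OF continuous_on_id] VG2]
      borel_measurable_continuous_on[OF continuous_on_snd[OF continuous_on_id] VG2]
    by (simp_all add: VG_def)
  have sub: "subalgebra F2 F1"
    unfolding F1_def F2_def
    by (rule subalgebra_vimage_vimage) (use V2 in \<open>simp_all add: F2_def\<close>)
  have h [measurable]: "h \<in> borel_measurable borel"
    unfolding h_def by (rule cond_exp_at_measurable[OF VG])
  have p [measurable]: "p g \<in> borel_measurable borel" for g
    unfolding p_def by (rule cond_exp_at_measurable) measurable
  have hVG: "AE \<omega> in M. h (VG \<omega>) = real_cond_exp M F2 f \<omega>"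
    unfolding h_def F2_def by (rule AE_cond_exp_at[OF VG])
  have key: "AE \<omega> in M. h (V \<omega>, g) * p g (V \<omega>) = c \<omega> * p g (V \<omega>)" if g: "g \<in> {0, 1}" for g
  proof -
    define I :: "'a \<Rightarrow> real" where "I = indicator {\<omega>\<in>space M. G \<omega> = g}"
    have E: "{\<omega>\<in>space M. G \<omega> = g} \<in> sets M"
      by measurable
    have spF2: "space F2 = space M"
      by (simp add: F2_def)
    have E2: "{\<omega>\<in>space M. G \<omega> = g} \<in> sets F2"
      unfolding spF2[symmetric] by measurable
    have I [measurable]: "I \<in> borel_measurable M" "I \<in> borel_measurable F2"
      "AE \<omega> in M. \<bar>I \<omega>\<bar> \<le> 1"
      using E E2 by (simp_all add: I_def)
    have If: "integrable M (\<lambda>\<omega>. I \<omega> * f \<omega>)"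
      by (rule integrable_mult_AE_bounded[OF f I(1,3)])
    \<comment> \<open>On the event \<open>G = g\<close> the values \<open>h (VG \<omega>)\<close>
      and \<open>h (V \<omega>, g)\<close> agree; off it both sides are 0. Freezing the second
      argument at \<open>g\<close> makes the first factor sigma(V)-measurable, so that it can later
      be pulled out of the conditioning on \<open>V\<close>.\<close>
    have 1: "AE \<omega> in M. real_cond_exp M F2 (\<lambda>\<omega>. I \<omega> * f \<omega>) \<omega> = h (V \<omega>, g) * I \<omega>"
    proof -
      have "AE \<omega> in M. real_cond_exp M F2 (\<lambda>\<omega>. I \<omega> * f \<omega>) \<omega> = I \<omega> * real_cond_exp M F2 f \<omega>"
        by (rule F2.real_cond_exp_mult) (use f If in simp_all)
      with hVG show ?thesis
        by eventually_elim (auto simp: I_def indicator_def VG_def)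
    qed
    have meas: "(\<lambda>\<omega>. h (V \<omega>, g)) \<in> borel_measurable F1"
      by measurable
    have [measurable]: "(\<lambda>\<omega>. h (V \<omega>, g)) \<in> borel_measurable M"
      by measurable
    \<comment> \<open>\<open>h (V \<omega>, g)\<close> alone may fail to be integrable, being
      arbitrary where group \<open>g\<close> has probability 0; the product inherits integrability
      from the conditional expectation it represents.\<close>
    have "integrable M (real_cond_exp M F2 (\<lambda>\<omega>. I \<omega> * f \<omega>))"
      by (rule F2.real_cond_exp_int(1)[OF If])
    with 1 have hI: "integrable M (\<lambda>\<omega>. h (V \<omega>, g) * I \<omega>)"
      by (subst integrable_cong_AE[symmetric]) auto
    have 2: "AE \<omega> in M. real_cond_exp M F1 (real_cond_exp M F2 (\<lambda>\<omega>. I \<omega> * f \<omega>)) \<omega> =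
      real_cond_exp M F1 (\<lambda>\<omega>. I \<omega> * f \<omega>) \<omega>"
      by (rule F1.real_cond_exp_nested_subalg[OF F2.subalg sub If])
    have 3: "AE \<omega> in M. real_cond_exp M F1 (real_cond_exp M F2 (\<lambda>\<omega>. I \<omega> * f \<omega>)) \<omega> =
      real_cond_exp M F1 (\<lambda>\<omega>. h (V \<omega>, g) * I \<omega>) \<omega>"
      by (rule F1.real_cond_exp_cong[OF 1]) measurable
    have 4: "AE \<omega> in M. real_cond_exp M F1 (\<lambda>\<omega>. h (V \<omega>, g) * I \<omega>) \<omega> =
      h (V \<omega>, g) * real_cond_exp M F1 I \<omega>"
      by (rule F1.real_cond_exp_mult[OF meas I(1) hI])
    have 5: "AE \<omega> in M. p g (V \<omega>) = real_cond_exp M F1 I \<omega>"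
      unfolding p_def I_def F1_def by (rule AE_cond_exp_at) measurable
    have 6: "AE \<omega> in M. real_cond_exp M F1 (\<lambda>\<omega>. I \<omega> * f \<omega>) \<omega> = c \<omega> * real_cond_exp M F1 I \<omega>"
      using c[OF g] by (simp add: I_def F1_def mult.commute)
    show ?thesis
      using 2 3 4 5 6 by eventually_elim simp
  qed
  have "AE \<omega> in M. 0 < p 0 (V \<omega>) \<and> 0 < p 1 (V \<omega>) \<longrightarrow> h (V \<omega>, 1) - h (V \<omega>, 0) = 0"
    using key[of 0, simplified] key[of 1, simplified] by eventually_elim auto
  \<comment> \<open>Measurability of this set is what lets the statement pass from \<open>M\<close>
    to the law of \<open>V\<close>.\<close>
  moreover have "{v \<in> space borel. 0 < p 0 v \<and> 0 < p 1 v \<longrightarrow> h (v, 1) - h (v, 0) = 0} \<in> sets borel"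
    by measurable
  ultimately have "AE v in distr M borel V. 0 < p 0 v \<and> 0 < p 1 v \<longrightarrow> h (v, 1) - h (v, 0) = 0"
    by (subst AE_distr_iff) auto
  then show ?thesis
    by (simp add: both_groups_at_def group_gap_def p_def h_def VG_def[abs_def])
qed

section \<open>Calibration and mean squared error of a conditional expectation\<close>

text \<open>With Z = E[f | V], sigma(Z) lies inside sigma(V), and the tower property gives E[f | Z]
  = E[Z | Z] = Z.\<close>

lemma (in finite_measure) globally_calibrated_cexp:
  assumes V: "V \<in> measurable M N" and f: "integrable M f"
  shows "globally_calibrated M f (cexp M N V f)"
proof -
  define Z where "Z = cexp M N V f"
  have Z [measurable]: "Z \<in> borel_measurable M"
    by (simp add: Z_def)
  interpret V: finite_measure_subalgebra M "vimage_algebra (space M) V N"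
    by (rule finite_measure_subalgebra_vimage[OF V])
  interpret Z: finite_measure_subalgebra M "vimage_algebra (space M) Z borel"
    by (rule finite_measure_subalgebra_vimage[OF Z])
  have sub: "subalgebra (vimage_algebra (space M) V N) (vimage_algebra (space M) Z borel)"
    by (intro subalgebra_vimage_vimage) (simp_all add: Z_def)
  have ZZ: "Z \<in> borel_measurable (vimage_algebra (space M) Z borel)"
    by (rule measurable_vimage_algebra1) simp
  have "AE \<omega> in M. cexp M borel Z Z \<omega> = cexp M borel Z f \<omega>"
    using Z.real_cond_exp_nested_subalg[OF V.subalg sub f] by (simp add: Z_def)
  moreover have "AE \<omega> in M. cexp M borel Z Z \<omega> = Z \<omega>"
    by (rule Z.real_cond_exp_F_meas[OF _ ZZ]) (simp add: Z_def V.real_cond_exp_int(1)[OF f])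
  moreover have "AE \<omega> in M. cond_exp_at M borel Z f (Z \<omega>) = cexp M borel Z f \<omega>"
    by (rule AE_cond_exp_at[OF Z])
  ultimately have "AE \<omega> in M. cond_exp_at M borel Z f (Z \<omega>) = Z \<omega>"
    by eventually_elim simp
  then show ?thesis
    using cond_exp_at_measurable[OF Z, of f]
    by (subst globally_calibrated_def, subst Z_def[symmetric], subst AE_distr_iff)
      (auto simp: Z_def)
qed

text \<open>Turns the assumption on the expected conditional variance into one on the mean squared
  error, by the law of total expectation.\<close>

lemma (in finite_measure) cexp_square_deviation:
  fixes f :: "'a \<Rightarrow> real"
  assumes V: "V \<in> measurable M N" and f [measurable]: "f \<in> borel_measurable M"
    and f2: "integrable M (\<lambda>\<omega>. (f \<omega>)\<^sup>2)"
  shows "integrable M (\<lambda>\<omega>. (f \<omega> - cexp M N V f \<omega>)\<^sup>2)"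
    and "(\<integral>\<omega>. cond_variance M N V f \<omega> \<partial>M) = (\<integral>\<omega>. (f \<omega> - cexp M N V f \<omega>)\<^sup>2 \<partial>M)"
proof -
  interpret V: finite_measure_subalgebra M "vimage_algebra (space M) V N"
    by (rule finite_measure_subalgebra_vimage[OF V])
  have int: "integrable M f"
    by (rule square_integrable_imp_integrable[OF f f2])
  \<comment> \<open>Conditional Jensen inequality for the square.\<close>
  have Z2: "integrable M (\<lambda>\<omega>. (cexp M N V f \<omega>)\<^sup>2)"
    by (rule V.integrable_convex_cond_exp[OF int, of UNIV]) (auto simp: f2 convex_power2)
  show *: "integrable M (\<lambda>\<omega>. (f \<omega> - cexp M N V f \<omega>)\<^sup>2)"
  proof (rule Bochner_Integration.integrable_bound)
    show "integrable M (\<lambda>\<omega>. 2 * (f \<omega>)\<^sup>2 + 2 * (cexp M N V f \<omega>)\<^sup>2)"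
      using f2 Z2 by simp
    show "AE \<omega> in M. norm ((f \<omega> - cexp M N V f \<omega>)\<^sup>2) \<le>
        norm (2 * (f \<omega>)\<^sup>2 + 2 * (cexp M N V f \<omega>)\<^sup>2)"
    proof (rule AE_I2)
      fix \<omega>
      have "(a - b)\<^sup>2 \<le> 2 * a\<^sup>2 + 2 * b\<^sup>2" for a b :: real
        using zero_le_power2[of "a + b"] by (simp add: power2_eq_square algebra_simps)
      then show "norm ((f \<omega> - cexp M N V f \<omega>)\<^sup>2) \<le> norm (2 * (f \<omega>)\<^sup>2 + 2 * (cexp M N V f \<omega>)\<^sup>2)"
        by simp
    qed
  qed measurable
  show "(\<integral>\<omega>. cond_variance M N V f \<omega> \<partial>M) = (\<integral>\<omega>. (f \<omega> - cexp M N V f \<omega>)\<^sup>2 \<partial>M)"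
    unfolding cond_variance_def by (rule V.real_cond_exp_int(2)[OF *])
qed

section \<open>Independence and constant conditional probabilities\<close>

lemma (in prob_space) cexp_indep_var:
  assumes ind: "indep_var NA A NV V" and T: "T \<in> sets NA"
  shows "AE \<omega> in M. cexp M NV V (indicator {\<omega>\<in>space M. A \<omega> \<in> T}) \<omega> = prob {\<omega>\<in>space M. A \<omega> \<in> T}"
proof -
  have A [measurable]: "A \<in> measurable M NA" and V: "V \<in> measurable M NV"
    using ind by (auto simp: indep_var_eq)
  interpret V: finite_measure_subalgebra M "vimage_algebra (space M) V NV"
    by (rule finite_measure_subalgebra_vimage[OF V])
  have E [measurable]: "{\<omega>\<in>space M. A \<omega> \<in> T} \<in> sets M"
    using T by measurable
  show ?thesis
  proof (rule V.real_cond_exp_charact)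
    fix D assume "D \<in> sets (vimage_algebra (space M) V NV)"
    then obtain C where C: "C \<in> sets NV" "D = V -` C \<inter> space M"
      using V by (auto simp: sets_vimage_algebra2 measurable_space)
    have D [measurable]: "D \<in> sets M"
      using C V by (simp add: measurable_sets)
    have "prob ({\<omega>\<in>space M. A \<omega> \<in> T} \<inter> D) = prob {\<omega>\<in>space M. A \<omega> \<in> T} * prob D"
    proof -
      have "(\<lambda>\<omega>. (A \<omega>, V \<omega>)) -` (T \<times> C) \<inter> space M = {\<omega>\<in>space M. A \<omega> \<in> T} \<inter> D"
        and "A -` T \<inter> space M = {\<omega>\<in>space M. A \<omega> \<in> T}"
        using C by auto
      then show ?thesis
        using indep_varD[OF ind T C(1)] C by simp
    qed
    moreover have "(\<integral>\<omega>\<in>D. indicator {\<omega>\<in>space M. A \<omega> \<in> T} \<omega> \<partial>M) =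
        prob ({\<omega>\<in>space M. A \<omega> \<in> T} \<inter> D)"
    proof -
      have "(\<lambda>\<omega>. indicator D \<omega> *\<^sub>R indicator {\<omega>\<in>space M. A \<omega> \<in> T} \<omega>) =
          (indicator ({\<omega>\<in>space M. A \<omega> \<in> T} \<inter> D) :: _ \<Rightarrow> real)"
        by (auto simp: indicator_def)
      moreover have "(\<integral>\<omega>. indicator ({\<omega>\<in>space M. A \<omega> \<in> T} \<inter> D) \<omega> \<partial>M) =
          prob ({\<omega>\<in>space M. A \<omega> \<in> T} \<inter> D)"
        using E D by (subst Bochner_Integration.integral_indicator) (auto intro!: arg_cong[where f=prob])
      ultimately show ?thesis
        by (simp add: set_lebesgue_integral_def)
    qed
    moreover have "(\<integral>\<omega>\<in>D. prob {\<omega>\<in>space M. A \<omega> \<in> T} \<partial>M) =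
        prob {\<omega>\<in>space M. A \<omega> \<in> T} * prob D"
      using sets.sets_into_space[OF D]
      by (simp add: set_lebesgue_integral_def Int_absorb2 mult.commute)
    ultimately show "(\<integral>\<omega>\<in>D. indicator {\<omega>\<in>space M. A \<omega> \<in> T} \<omega> \<partial>M) =
        (\<integral>\<omega>\<in>D. prob {\<omega>\<in>space M. A \<omega> \<in> T} \<partial>M)"
      by simp
  qed (use E in \<open>auto simp: less_top[symmetric]\<close>)
qed

text \<open>A contraction property: \<open>G\<close> independent of \<open>Y\<close>, and of
  \<open>W\<close> given \<open>Y\<close>, is independent of \<open>W\<close>. For D in sigma(W) and
  E the event \<open>G\<close> in \<open>T\<close>, P(D and E) = E[P(D | Y) P(E | Y)] = P(E) P(D),
  as P(E | Y) is constant.\<close>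

lemma (in prob_space) cond_indep_var_imp_cexp_const:
  assumes W: "W \<in> measurable M NW"
    and ci: "cond_indep_var M NW W NG G NY Y"
    and ind: "indep_var NG G NY Y"
    and T: "T \<in> sets NG"
  shows "AE \<omega> in M. cexp M NW W (indicator {\<omega>\<in>space M. G \<omega> \<in> T}) \<omega> = prob {\<omega>\<in>space M. G \<omega> \<in> T}"
proof -
  define E where "E = {\<omega>\<in>space M. G \<omega> \<in> T}"
  have G: "G \<in> measurable M NG" and Y: "Y \<in> measurable M NY"
    using ind by (auto simp: indep_var_eq)
  interpret W: finite_measure_subalgebra M "vimage_algebra (space M) W NW"
    by (rule finite_measure_subalgebra_vimage[OF W])
  interpret Y: finite_measure_subalgebra M "vimage_algebra (space M) Y NY"
    by (rule finite_measure_subalgebra_vimage[OF Y])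
  have E [measurable]: "E \<in> sets M"
    unfolding E_def using G T by measurable
  have "AE \<omega> in M. cexp M NW W (indicator E) \<omega> = prob E"
  proof (rule W.real_cond_exp_charact)
    fix D assume D: "D \<in> sets (vimage_algebra (space M) W NW)"
    have DM [measurable]: "D \<in> sets M"
      using W.subalg D by (auto simp: subalgebra_def)
    have intD: "integrable M (indicator D :: _ \<Rightarrow> real)"
      by (simp add: less_top[symmetric])
    have intDE: "integrable M (\<lambda>\<omega>. indicator D \<omega> * indicator E \<omega> :: real)"
      by (rule integrable_mult_AE_bounded[where c=1])
        (simp_all add: less_top[symmetric] indicator_def[of D])
    have "(\<integral>\<omega>. indicator D \<omega> * indicator E \<omega> \<partial>M) =
        (\<integral>\<omega>. cexp M NY Y (\<lambda>\<omega>. indicator D \<omega> * indicator E \<omega>) \<omega> \<partial>M)"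
      by (rule Y.real_cond_exp_int(2)[OF intDE, symmetric])
    also have "\<dots> = (\<integral>\<omega>. prob E * cexp M NY Y (indicator D) \<omega> \<partial>M)"
    proof (rule integral_cong_AE)
      have "AE \<omega> in M. cexp M NY Y (\<lambda>\<omega>. indicator D \<omega> * indicator E \<omega>) \<omega> =
          cexp M NY Y (indicator D) \<omega> * cexp M NY Y (indicator E) \<omega>"
        unfolding E_def
        by (rule cond_indep_var_cexp_mult[OF W G Y ci intD _ T]) (use D in simp)
      moreover have "AE \<omega> in M. cexp M NY Y (indicator E) \<omega> = prob E"
        unfolding E_def by (rule cexp_indep_var[OF ind T])
      ultimately show "AE \<omega> in M. cexp M NY Y (\<lambda>\<omega>. indicator D \<omega> * indicator E \<omega>) \<omega> =
          prob E * cexp M NY Y (indicator D) \<omega>"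
        by eventually_elim simp
    qed simp_all
    also have "\<dots> = prob E * (\<integral>\<omega>. indicator D \<omega> \<partial>M)"
      using Y.real_cond_exp_int(2)[OF intD] by simp
    finally show "(\<integral>\<omega>\<in>D. indicator E \<omega> \<partial>M) = (\<integral>\<omega>\<in>D. prob E \<partial>M)"
      by (simp add: set_lebesgue_integral_def mult.commute)
  qed (auto simp: less_top[symmetric])
  then show ?thesis
    by (simp add: E_def)
qed

section \<open>The score \<open>Z\<close> built from the selected features\<close>

theorem proposition4:
  fixes M :: "'a measure"
    and Y G Z :: "'a \<Rightarrow> real"
    and X :: "'a \<Rightarrow> real ^ 'k"
    and S :: "'k set"
    and W :: "'a \<Rightarrow> 'k \<Rightarrow> real"
    and \<W> :: "('k \<Rightarrow> real) measure"
  assumes "prob_space M"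
    and "Y \<in> borel_measurable M" and "integrable M (\<lambda>\<omega>. (Y \<omega>)\<^sup>2)"
    and "G \<in> borel_measurable M" and "\<And>\<omega>. \<omega> \<in> space M \<Longrightarrow> G \<omega> \<in> {0, 1}"
    and "X \<in> borel_measurable M"
    and "W = (\<lambda>\<omega>. \<lambda>i\<in>S. X \<omega> $ i)" and "\<W> = Pi\<^sub>M S (\<lambda>_. borel)"
    and "Z = cexp M \<W> W Y"
    and A1: "prob_space.expectation M (cond_variance M \<W> W Y) > 0"
    and A2: "cond_indep_var M borel Y borel G \<W> W"
    and A3: "cond_indep_var M \<W> W borel G borel Y"
    and A4: "prob_space.variance M (cexp M \<W> W G) > 0"
  shows "globally_calibrated M Y Z
    \<and> \<not> prob_space.indep_var M borel G borel Y
    \<and> \<not> oracle_score M Y Z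
    \<and> prob_space.expectation M (\<lambda>\<omega>. (Y \<omega> - Z \<omega>)\<^sup>2) > 0
    \<and> (AE z in distr M borel Z. both_groups_at M G Z z \<longrightarrow> \<delta>\<^sub>C M G Y Z z = 0)
    \<and> (AE y in distr M borel Y. both_groups_at M G Y y \<longrightarrow> \<delta>\<^sub>B M G Y Z y = 0)"
proof -
  note [measurable] = assms(2,4,6)
  interpret prob_space M by fact
  have WM [measurable]: "W \<in> measurable M \<W>"
    unfolding assms(7,8)
    by (intro measurable_restrict measurable_compose[OF assms(6) borel_measurable_nth])
  have Yint: "integrable M Y"
    by (rule square_integrable_imp_integrable) fact+
  interpret W: finite_measure_subalgebra M "vimage_algebra (space M) W \<W>"
    by (rule finite_measure_subalgebra_vimage[OF WM])
  have ZW: "Z \<in> borel_measurable (vimage_algebra (space M) W \<W>)"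
    by (simp add: assms(9))
  have Z [measurable]: "Z \<in> borel_measurable M"
    by (simp add: assms(9))
  have Zint: "integrable M Z"
    unfolding assms(9) by (rule W.real_cond_exp_int(1)[OF Yint])
  interpret Z: finite_measure_subalgebra M "vimage_algebra (space M) Z borel"
    by (rule finite_measure_subalgebra_vimage[OF Z])
  have sub: "subalgebra (vimage_algebra (space M) W \<W>) (vimage_algebra (space M) Z borel)"
    using ZW by (intro subalgebra_vimage_vimage) simp_all
  have ZZ: "Z \<in> borel_measurable (vimage_algebra (space M) Z borel)"
    by (rule measurable_vimage_algebra1) simp

  have mse: "expectation (\<lambda>\<omega>. (Y \<omega> - Z \<omega>)\<^sup>2) > 0"
    using A1 cexp_square_deviation(2)[OF WM assms(2,3)] by (simp add: assms(9))

  have "\<not> oracle_score M Y Z"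
  proof
    assume "oracle_score M Y Z"
    then have "expectation (\<lambda>\<omega>. (Y \<omega> - Z \<omega>)\<^sup>2) = expectation (\<lambda>\<omega>. 0)"
      unfolding oracle_score_def by (intro integral_cong_AE) auto
    with mse show False by simp
  qed

  moreover have "\<not> indep_var borel G borel Y"
  proof
    assume ind: "indep_var borel G borel Y"
    have "AE \<omega> in M. cexp M \<W> W (indicator {\<omega>\<in>space M. G \<omega> \<in> {1}}) \<omega> = prob {\<omega>\<in>space M. G \<omega> \<in> {1}}"
      by (rule cond_indep_var_imp_cexp_const[OF WM A3 ind]) simp
    \<comment> \<open>\<open>G\<close> takes only the values 0 and 1, so it is the indicator of its
      own event \<open>G = 1\<close>.\<close>
    moreover have "AE \<omega> in M. cexp M \<W> W G \<omega> = cexp M \<W> W (indicator {\<omega>\<in>space M. G \<omega> \<in> {1}}) \<omega>"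
      by (rule W.real_cond_exp_cong) (use assms(5) in \<open>auto simp: indicator_def\<close>)
    ultimately have const: "AE \<omega> in M. cexp M \<W> W G \<omega> = prob {\<omega>\<in>space M. G \<omega> \<in> {1}}"
      by eventually_elim simp
    then have "expectation (cexp M \<W> W G) = expectation (\<lambda>\<omega>. prob {\<omega>\<in>space M. G \<omega> \<in> {1}})"
      by (intro integral_cong_AE) auto
    then have mean: "expectation (cexp M \<W> W G) = prob {\<omega>\<in>space M. G \<omega> \<in> {1}}"
      by (simp add: prob_space)
    \<comment> \<open>An almost surely constant variable equals its mean, so its variance is 0,
      against \<open>A4\<close>.\<close>
    from const have "variance (cexp M \<W> W G) = expectation (\<lambda>\<omega>. 0)"
      unfolding mean by (intro integral_cong_AE) auto
    with A4 show False by simp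
  qed

  moreover have "globally_calibrated M Y Z"
    unfolding assms(9) by (rule globally_calibrated_cexp[OF WM Yint])

  moreover have "AE z in distr M borel Z. both_groups_at M G Z z \<longrightarrow> \<delta>\<^sub>C M G Y Z z = 0"
    unfolding miscalibration_def
  proof (rule AE_group_gap_eq_0[OF Z assms(4) Yint, where c = Z])
    fix g :: real
    define I :: "'a \<Rightarrow> real" where "I = indicator {\<omega>\<in>space M. G \<omega> = g}"
    have I [measurable]: "I \<in> borel_measurable M" "integrable M I" "AE \<omega> in M. \<bar>I \<omega>\<bar> \<le> 1"
      by (auto simp: I_def less_top[symmetric])
    have YI: "integrable M (\<lambda>\<omega>. Y \<omega> * I \<omega>)"
      using integrable_mult_AE_bounded[OF Yint I(1,3)] by (simp add: mult.commute)
    have P1: "AE \<omega> in M. \<bar>cexp M \<W> W I \<omega>\<bar> \<le> 1"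
      unfolding I_def by (rule W.AE_abs_real_cond_exp_indicator_le_1) simp
    have ZP: "integrable M (\<lambda>\<omega>. Z \<omega> * cexp M \<W> W I \<omega>)"
      using integrable_mult_AE_bounded[OF Zint _ P1] by (simp add: mult.commute)
    have YY: "Y \<in> borel_measurable (vimage_algebra (space M) Y borel)"
      by (rule measurable_vimage_algebra1) simp
    \<comment> \<open>\<open>A2\<close> extended from events to \<open>f = Y\<close>, with E[Y | W]
      being \<open>Z\<close> by definition.\<close>
    have 1: "AE \<omega> in M. cexp M \<W> W (\<lambda>\<omega>. Y \<omega> * I \<omega>) \<omega> = Z \<omega> * cexp M \<W> W I \<omega>"
      using cond_indep_var_cexp_mult[OF assms(2,4) WM A2 Yint YY, of "{g}"]
      by (simp add: I_def assms(9))
    \<comment> \<open>From here the identity given \<open>W\<close> is conditioned down to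
      \<open>Z\<close>: the factor \<open>Z\<close> comes out, and the tower property removes the
      inner conditioning on both sides.\<close>
    have 2: "AE \<omega> in M. cexp M borel Z (cexp M \<W> W (\<lambda>\<omega>. Y \<omega> * I \<omega>)) \<omega> =
        cexp M borel Z (\<lambda>\<omega>. Z \<omega> * cexp M \<W> W I \<omega>) \<omega>"
      by (rule Z.real_cond_exp_cong[OF 1]) measurable
    have 3: "AE \<omega> in M. cexp M borel Z (\<lambda>\<omega>. Z \<omega> * cexp M \<W> W I \<omega>) \<omega> =
        Z \<omega> * cexp M borel Z (cexp M \<W> W I) \<omega>"
      by (rule Z.real_cond_exp_mult[OF ZZ _ ZP]) simp
    have 4: "AE \<omega> in M. cexp M borel Z (cexp M \<W> W I) \<omega> = cexp M borel Z I \<omega>"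
      by (rule Z.real_cond_exp_nested_subalg[OF W.subalg sub I(2)])
    have 5: "AE \<omega> in M. cexp M borel Z (cexp M \<W> W (\<lambda>\<omega>. Y \<omega> * I \<omega>)) \<omega> =
        cexp M borel Z (\<lambda>\<omega>. Y \<omega> * I \<omega>) \<omega>"
      by (rule Z.real_cond_exp_nested_subalg[OF W.subalg sub YI])
    have "AE \<omega> in M. cexp M borel Z (\<lambda>\<omega>. Y \<omega> * I \<omega>) \<omega> = Z \<omega> * cexp M borel Z I \<omega>"
      using 2 3 4 5 by eventually_elim simp
    then show "AE \<omega> in M. cexp M borel Z (\<lambda>\<omega>. Y \<omega> * indicator {\<omega>\<in>space M. G \<omega> = g} \<omega>) \<omega> =
        Z \<omega> * cexp M borel Z (indicator {\<omega>\<in>space M. G \<omega> = g}) \<omega>"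
      by (simp add: I_def)
  qed

  moreover have "AE y in distr M borel Y. both_groups_at M G Y y \<longrightarrow> \<delta>\<^sub>B M G Y Z y = 0"
    unfolding imbalance_def
  \<comment> \<open>\<open>A3\<close> concerns \<open>W\<close>, but \<open>Z\<close> is
    sigma(W)-measurable and integrable, so the product rule given \<open>Y\<close> applies to it
    directly.\<close>
  proof (rule AE_group_gap_eq_0[OF assms(2,4) Zint, where c = "cexp M borel Y Z"])
    fix g :: real
    show "AE \<omega> in M. cexp M borel Y (\<lambda>\<omega>. Z \<omega> * indicator {\<omega>\<in>space M. G \<omega> = g} \<omega>) \<omega> =
        cexp M borel Y Z \<omega> * cexp M borel Y (indicator {\<omega>\<in>space M. G \<omega> = g}) \<omega>"
      using cond_indep_var_cexp_mult[OF WM assms(4,2) A3 Zint ZW, of "{g}"] by simp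
  qed

  ultimately show ?thesis
    using mse by simp
qed

end
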